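(* Let $f(z)=\frac{a_0}{z}+\sum_{i\ge 2}^{\infty}\frac{a_i}{z^i}$ be an arbitrary germ of an analytic function near $\infty$ with $a_0>0$ (and $a_i\in\mathbb{C}$ for $i\ge 2$). Then there exist (families of) positive Borel measures $\mu$, compactly supported in $\mathbb{C}$, whose Cauchy transform coincides with $f$ near $\infty$, i.e. $\mathcal{C}_\mu(z)=f(z)$ for all $z$ in some neighborhood of $\infty$.
   Context: The Cauchy transform of a compactly supported measure $\mu$ in $\mathbb{C}$ is $\mathcal{C}_\mu(z)=\int_{\mathbb{C}}\frac{d\mu(\xi)}{z-\xi}$. The germ $f$ is given by a series in $1/z$ that converges for $|z|$ sufficiently large. *)

theory Defs
  imports "HOL-Analysis.Analysis"
begin

definition cauchy_transform :: "complex measure \<Rightarrow> complex \<Rightarrow> complex" where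
  "cauchy_transform \<mu> z = (\<integral>\<xi>. 1 / (z - \<xi>) \<partial>\<mu>)"

definition measure_support :: "'a::topological_space measure \<Rightarrow> 'a set" where
  "measure_support \<mu> = {x. \<forall>U. open U \<longrightarrow> x \<in> U \<longrightarrow> emeasure \<mu> U > 0}"

text \<open>Positivity is built into the type of measures. Finiteness is the usual convention that
  a Borel measure is finite on compact sets; together with compactness of the support it makes
  the integral defining the Cauchy transform converge at every point off the support, so that
  the default value of a non-convergent integral plays no role near infinity.\<close>

definition compactly_supported_borel_measure :: "complex measure \<Rightarrow> bool" where
  "compactly_supported_borel_measure \<mu> \<longleftrightarrow>
     sets \<mu> = sets borel \<and> finite_measure \<mu> \<and> compact (measure_support \<mu>)"

end

(* The Cauchy transform of a measure on the circle |w| = r is, near infinity, the generating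
   series of its moments, and the m-th moment is r^m times a Fourier coefficient.  The real
   density a0 + 2 Re (\<Sum>k. c k e^{-(k+1)i\<theta>}) with c k = a (k+2) / r^(k+1) has exactly the moments
   prescribed by f, and it is nonnegative as soon as r is large, because the c k are then small
   compared with a0.  Different radii give different measures. *)
theory Submission imports Defs begin

section \<open>Integration over the parameter interval of the circle\<close>

text \<open>The circle is parametrised by \<open>cis (2 * pi * t)\<close>. The parameter has total
  mass 1, so no factor 1/(2 pi) enters the Fourier coefficients.\<close>

abbreviation unit_interval :: "real measure" where
  "unit_interval \<equiv> restrict_space lborel {0..1}"

lemma space_unit_interval [simp]: "space unit_interval = {0..1}"
  by (simp add: space_restrict_space)

lemma measure_unit_interval: "measure unit_interval {0..1} = 1"
  by (simp add: measure_restrict_space)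

lemma finite_measure_unit_interval: "finite_measure unit_interval"
  by (rule finite_measureI) (simp add: emeasure_restrict_space)

lemma borel_measurable_unit_interval:
  "f \<in> borel_measurable borel \<Longrightarrow> f \<in> borel_measurable unit_interval"
  by (rule measurable_restrict_space1) simp

lemma integrable_bounded_unit_interval:
  fixes f :: "real \<Rightarrow> 'b::{banach, second_countable_topology}"
  assumes "f \<in> borel_measurable borel" "\<And>t. norm (f t) \<le> B"
  shows "integrable unit_interval f"
  using finite_measure.integrable_const_bound[OF finite_measure_unit_interval, of f B] assms
  by (simp add: borel_measurable_unit_interval)

text \<open>A Weierstrass majorant suffices: as the total mass is 1, the uniform bound
  \<open>b k\<close> also bounds the L1 norm of \<open>u k\<close>. This serves both the Fourier
  series of the density and the geometric series of the Cauchy kernel.\<close>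

lemma integral_suminf_unit_interval:
  fixes u :: "nat \<Rightarrow> real \<Rightarrow> 'b::{banach, second_countable_topology}"
  assumes meas: "\<And>k. u k \<in> borel_measurable borel"
    and bound: "\<And>k t. norm (u k t) \<le> b k" and "summable b"
  shows "(\<integral>t. (\<Sum>k. u k t) \<partial>unit_interval) = (\<Sum>k. \<integral>t. u k t \<partial>unit_interval)"
proof (rule integral_suminf)
  have nonneg: "b k \<ge> 0" for k
    using bound[of k 0] norm_ge_zero order_trans by blast
  show int: "integrable unit_interval (u k)" for k
    using meas bound by (rule integrable_bounded_unit_interval)
  show "AE t in unit_interval. summable (\<lambda>k. norm (u k t))"
    by (intro AE_I2 summable_comparison_test'[OF \<open>summable b\<close>, of 0]) (simp add: bound)
  have "(\<integral>t. norm (u k t) \<partial>unit_interval) \<le> b k" for k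
  proof -
    have "(\<integral>t. norm (u k t) \<partial>unit_interval) \<le> (\<integral>t. b k \<partial>unit_interval)"
    proof (rule integral_mono)
      show "integrable unit_interval (\<lambda>t. norm (u k t))"
        using int by (rule integrable_norm)
      show "integrable unit_interval (\<lambda>t. b k)"
        by (rule integrable_bounded_unit_interval[of _ "b k"]) (simp_all add: nonneg)
    qed (rule bound)
    then show ?thesis by (simp add: measure_unit_interval)
  qed
  then show "summable (\<lambda>k. \<integral>t. norm (u k t) \<partial>unit_interval)"
    by (intro summable_comparison_test'[OF \<open>summable b\<close>, of 0]) simp
qed

section \<open>Orthogonality of the characters\<close>

lemma borel_measurable_cis [measurable]:
  "(\<lambda>t. cis (c * t)) \<in> borel_measurable borel"
  by (intro borel_measurable_continuous_onI continuous_intros)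

text \<open>For \<open>n\<close> nonzero the integrand has the antiderivative cis(wt)/(iw) with w =
  2 pi n, which takes equal values at 0 and 1.\<close>

lemma integral_cis_unit_interval:
  fixes n :: int
  shows "(\<integral>t. cis (2 * pi * n * t) \<partial>unit_interval) = (if n = 0 then 1 else 0)"
proof (cases "n = 0")
  case True
  then show ?thesis by (simp add: measure_unit_interval)
next
  case False
  define w where "w = 2 * pi * n"
  have w: "w \<noteq> 0" using False by (simp add: w_def)
  have "((\<lambda>t. cis (w * t) / (\<i> * w)) has_vector_derivative cis (w * t)) (at t within {0..1})" for t
    unfolding cis_conv_exp using w
    by (auto intro!: derivative_eq_intros has_vector_derivative_real_field simp: field_simps)
  then have "(\<integral>t. indicator {0..1} t *\<^sub>R cis (w * t) \<partial>lborel)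
      = cis (w * 1) / (\<i> * w) - cis (w * 0) / (\<i> * w)"
    by (intro integral_FTC_atLeastAtMost continuous_intros) auto
  moreover have "cis w = 1"
    using cis_multiple_2pi[of n] by (simp add: w_def mult_ac)
  ultimately show ?thesis
    using False by (simp add: integral_restrict_space set_lebesgue_integral_def w_def)
qed

section \<open>The density and its Fourier coefficients\<close>

text \<open>Since 2 Re w = w + cnj w, this is the real Fourier series with coefficient
  \<open>c k\<close> at frequency -(k+1), \<open>cnj (c k)\<close> at k+1, and mean
  \<open>a0\<close>. The minus sign makes \<open>c k\<close> visible to the moment of order k+1,
  whose integrand carries the opposite frequency.\<close>

definition fourier_density :: "real \<Rightarrow> (nat \<Rightarrow> complex) \<Rightarrow> real \<Rightarrow> real" where
  "fourier_density a0 c t = a0 + (\<Sum>k. 2 * Re (c k * cis (2 * pi * (- int (Suc k)) * t)))"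

definition circle_measure :: "(real \<Rightarrow> real) \<Rightarrow> real \<Rightarrow> complex measure" where
  "circle_measure h r =
     distr (density unit_interval (\<lambda>t. ennreal (h t))) borel (\<lambda>t. r * cis (2 * pi * t))"

lemma fourier_density_measurable [measurable]: "fourier_density a0 c \<in> borel_measurable borel"
  unfolding fourier_density_def by measurable

text \<open>Termwise |2 Re w| <= 2 |w|. This one bound on the oscillating part gives both
  nonnegativity of the density, once it is at most \<open>a0\<close>, and boundedness, hence finite
  mass.\<close>

lemma abs_fourier_density_sum_le:
  assumes "summable (\<lambda>k. norm (c k))"
  shows "\<bar>\<Sum>k. 2 * Re (c k * cis (2 * pi * (- int (Suc k)) * t))\<bar> \<le> 2 * (\<Sum>k. norm (c k))"
proof -
  let ?g = "\<lambda>k. 2 * Re (c k * cis (2 * pi * (- int (Suc k)) * t))"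
  have le: "norm (?g k) \<le> 2 * norm (c k)" for k
    using abs_Re_le_cmod[of "c k * cis (2 * pi * (- int (Suc k)) * t)"]
    by (simp add: norm_mult abs_mult)
  have sm: "summable (\<lambda>k. 2 * norm (c k))" using assms by (rule summable_mult)
  have "norm (suminf ?g) \<le> (\<Sum>k. 2 * norm (c k))"
    by (rule norm_suminf_le[OF le sm])
  then show ?thesis using assms by (simp add: suminf_mult)
qed

lemma fourier_density_nonneg:
  assumes "summable (\<lambda>k. norm (c k))" "2 * (\<Sum>k. norm (c k)) \<le> a0"
  shows "fourier_density a0 c t \<ge> 0"
  using abs_fourier_density_sum_le[OF assms(1), of t] assms(2) by (simp add: fourier_density_def)

lemma abs_fourier_density_le:
  assumes "summable (\<lambda>k. norm (c k))"
  shows "\<bar>fourier_density a0 c t\<bar> \<le> \<bar>a0\<bar> + 2 * (\<Sum>k. norm (c k))"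
  using abs_fourier_density_sum_le[OF assms(1), of t] by (simp add: fourier_density_def)

text \<open>Multiplying by the character of frequency \<open>m\<close> shifts all frequencies, and
  integration keeps only the term shifted to frequency 0.\<close>

lemma integral_fourier_density_cis:
  assumes c: "summable (\<lambda>k. norm (c k))"
  shows "(\<integral>t. fourier_density a0 c t * cis (2 * pi * int m * t) \<partial>unit_interval)
    = (case m of 0 \<Rightarrow> complex_of_real a0 | Suc k \<Rightarrow> c k)"
proof -
  define e where "e n t = cis (2 * pi * real_of_int n * t)" for n t
  have e_mult: "e n t * e n' t = e (n + n') t" for n n' t
    by (simp add: e_def cis_mult algebra_simps)
  have e_cnj: "cnj (e n t) = e (- n) t" for n t
    by (simp add: e_def cis_cnj)
  have e_norm: "norm (e n t) = 1" for n t by (simp add: e_def)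
  have e_meas [measurable]: "e n \<in> borel_measurable borel" for n
    unfolding e_def by measurable
  have e_int: "integrable unit_interval (\<lambda>t. w * e n t)" for n w
    by (rule integrable_bounded_unit_interval[of _ "norm w"]) (simp_all add: norm_mult e_norm)
  have e_val: "(\<integral>t. w * e n t \<partial>unit_interval) = (if n = 0 then w else 0)" for n w
    using integral_cis_unit_interval[of n] by (simp add: e_def)
  \<comment> \<open>The two summands come from 2 Re w = w + cnj w; multiplication by
    \<open>e m\<close> has raised both frequencies by \<open>m\<close>.\<close>
  define u where "u k t = c k * e (int m - int (Suc k)) t + cnj (c k) * e (int m + int (Suc k)) t"
    for k t
  have u_eq: "of_real (2 * Re (c k * e (- int (Suc k)) t)) * e m t = u k t" for k t
  proof -
    have "complex_of_real (2 * Re (c k * e (- int (Suc k)) t))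
        = c k * e (- int (Suc k)) t + cnj (c k) * e (int (Suc k)) t"
      unfolding complex_add_cnj[symmetric] by (simp add: e_cnj add.commute)
    moreover have "- int (Suc k) + int m = int m - int (Suc k)"
      "int (Suc k) + int m = int m + int (Suc k)" by simp_all
    ultimately show ?thesis
      by (simp only: u_def distrib_right mult.assoc e_mult)
  qed
  have u_meas: "u k \<in> borel_measurable borel" for k
    unfolding u_def by measurable
  have u_bound: "norm (u k t) \<le> 2 * norm (c k)" for k t
    unfolding u_def by (rule order_trans[OF norm_triangle_ineq]) (simp add: norm_mult e_norm)
  have sm: "summable (\<lambda>k. 2 * norm (c k))" using c by (rule summable_mult)
  have u_summable: "summable (\<lambda>k. u k t)" for t
    using u_bound by (rule summable_comparison_test'[OF sm, of 0])
  have g_summable: "summable (\<lambda>k. 2 * Re (c k * e (- int (Suc k)) t))" for t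
  proof (rule summable_comparison_test'[OF sm, of 0])
    show "norm (2 * Re (c k * e (- int (Suc k)) t)) \<le> 2 * norm (c k)" for k
      using abs_Re_le_cmod[of "c k * e (- int (Suc k)) t"] by (simp add: norm_mult abs_mult e_norm)
  qed
  have "fourier_density a0 c t * e m t = a0 * e m t + (\<Sum>k. u k t)" for t
  proof -
    have "complex_of_real (\<Sum>k. 2 * Re (c k * e (- int (Suc k)) t)) * e m t
       = (\<Sum>k. of_real (2 * Re (c k * e (- int (Suc k)) t)) * e m t)"
      unfolding suminf_of_real[OF g_summable]
      using summable_of_real[OF g_summable] by (rule suminf_mult2)
    also have "\<dots> = (\<Sum>k. u k t)" by (simp only: u_eq)
    finally show ?thesis
      unfolding fourier_density_def e_def[symmetric] by (simp only: of_real_add distrib_right)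
  qed
  then have "(\<integral>t. fourier_density a0 c t * e m t \<partial>unit_interval)
      = (\<integral>t. a0 * e m t + (\<Sum>k. u k t) \<partial>unit_interval)" by simp
  also have "\<dots> = (\<integral>t. a0 * e m t \<partial>unit_interval) + (\<integral>t. (\<Sum>k. u k t) \<partial>unit_interval)"
  proof (rule Bochner_Integration.integral_add[OF e_int])
    show "integrable unit_interval (\<lambda>t. \<Sum>k. u k t)"
      using u_meas by (intro integrable_bounded_unit_interval[of _ "\<Sum>k. 2 * norm (c k)"]
          norm_suminf_le[OF u_bound sm]) measurable
  qed
  also have "(\<integral>t. (\<Sum>k. u k t) \<partial>unit_interval) = (\<Sum>k. \<integral>t. u k t \<partial>unit_interval)"
    by (rule integral_suminf_unit_interval[OF u_meas u_bound sm])
  \<comment> \<open>As \<open>m\<close> is a natural number, the frequency \<open>m + Suc k\<close>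
    is positive and the conjugate summand integrates to 0. The other summand survives only for
    \<open>m = Suc k\<close>.\<close>
  also have "(\<lambda>k. \<integral>t. u k t \<partial>unit_interval) = (\<lambda>k. if m = Suc k then c k else 0)"
    unfolding u_def
    by (subst Bochner_Integration.integral_add[OF e_int e_int]) (use e_val[of 1] in auto)
  also have "(\<integral>t. a0 * e m t \<partial>unit_interval) + (\<Sum>k. if m = Suc k then c k else 0)
      = (case m of 0 \<Rightarrow> complex_of_real a0 | Suc k \<Rightarrow> c k)"
  proof (cases m)
    case (Suc j)
    have "(\<lambda>k. if j = k then c k else 0) sums c j"
      using sums_single[of j c] by (simp add: eq_commute)
    then show ?thesis using Suc e_val by (simp add: sums_unique[symmetric])
  qed (use e_val in simp)
  finally show ?thesis by (simp add: e_def)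
qed

section \<open>Measures carried by a circle\<close>

lemma circle_map_measurable:
  "(\<lambda>t. complex_of_real r * cis (2 * pi * t)) \<in> density unit_interval h \<rightarrow>\<^sub>M borel"
  by (simp add: borel_measurable_unit_interval)

text \<open>Change of variables for the image measure, then for the density. Nonnegativity of
  \<open>h\<close> enters because \<open>ennreal\<close> turns negative values into 0.\<close>

lemma integral_circle_measure:
  fixes g :: "complex \<Rightarrow> complex"
  assumes [measurable]: "g \<in> borel_measurable borel" "h \<in> borel_measurable borel"
    and "\<And>t. h t \<ge> 0"
  shows "(\<integral>\<xi>. g \<xi> \<partial>circle_measure h r)
    = (\<integral>t. h t * g (r * cis (2 * pi * t)) \<partial>unit_interval)"
  unfolding circle_measure_def
  by (subst integral_distr[OF circle_map_measurable assms(1)], subst integral_density)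
    (simp_all add: assms(3) borel_measurable_unit_interval scaleR_conv_of_real)

lemma sets_circle_measure: "sets (circle_measure h r) = sets borel"
  by (simp add: circle_measure_def)

text \<open>The parametrisation takes only values of modulus \<open>r\<close>, so the preimage of
  \<open>A\<close> is empty. This confines the support to the circle and later separates measures of
  different radii.\<close>

lemma emeasure_circle_measure_outside:
  assumes "r > 0" "A \<in> sets borel" "A \<inter> sphere 0 r = {}"
  shows "emeasure (circle_measure h r) A = 0"
proof -
  have "(\<lambda>t. r * cis (2 * pi * t)) -` A = {}"
    using assms by (auto simp: norm_mult)
  then show ?thesis
    by (simp add: circle_measure_def emeasure_distr[OF circle_map_measurable assms(2)])
qed

lemma finite_circle_measure:
  assumes [measurable]: "h \<in> borel_measurable borel" and "\<And>t. \<bar>h t\<bar> \<le> B"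
  shows "finite_measure (circle_measure h r)"
proof -
  have "(\<integral>\<^sup>+t. ennreal (h t) \<partial>unit_interval) < \<infinity>"
  proof -
    have "(\<integral>\<^sup>+t. ennreal (h t) \<partial>unit_interval) \<le> (\<integral>\<^sup>+t. ennreal B \<partial>unit_interval)"
      by (intro nn_integral_mono ennreal_leI) (use assms(2) abs_le_D1 in blast)
    also have "\<dots> < \<infinity>" by (simp add: emeasure_restrict_space)
    finally show ?thesis .
  qed
  moreover have "emeasure (density unit_interval h) {0..1} = (\<integral>\<^sup>+t. ennreal (h t) \<partial>unit_interval)"
    by (subst emeasure_density)
      (auto intro!: nn_integral_cong simp: borel_measurable_unit_interval sets_restrict_space_iff)
  ultimately have "finite_measure (density unit_interval h)"
    by (intro finite_measureI) auto
  then show ?thesis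
    unfolding circle_measure_def by (rule finite_measure.finite_measure_distr) (rule circle_map_measurable)
qed

lemma closed_measure_support: "closed (measure_support \<mu>)"
proof -
  have "- measure_support \<mu> = \<Union>{U. open U \<and> emeasure \<mu> U = 0}"
    by (auto simp: measure_support_def)
  then show ?thesis by (auto simp: closed_def intro!: open_Union)
qed

text \<open>Inclusion of the support in the circle is enough: a closed subset of a compact set is
  compact.\<close>

lemma compact_measure_support_circle_measure:
  assumes "r > 0"
  shows "compact (measure_support (circle_measure h r))"
proof -
  have "emeasure (circle_measure h r) (- sphere 0 r) = 0"
    by (rule emeasure_circle_measure_outside[OF assms]) auto
  moreover have "open (- sphere (0::complex) r)" by (simp add: open_Compl)
  ultimately have "measure_support (circle_measure h r) \<subseteq> sphere 0 r"
    by (force simp: measure_support_def)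
  then show ?thesis
    using closed_measure_support compact_sphere compact_Int_closed by (metis inf.absorb_iff2 inf_commute)
qed

section \<open>The Cauchy transform outside the circle\<close>

text \<open>For |\<xi>| = r < |z| the kernel is the geometric series of \<xi>^m / z^(m+1).
  Integrating it term by term leaves the moments, which are r^m times the Fourier coefficients
  computed above.\<close>

lemma cauchy_transform_circle_measure:
  fixes c :: "nat \<Rightarrow> complex" and z :: complex
  assumes c: "summable (\<lambda>k. norm (c k))" "2 * (\<Sum>k. norm (c k)) \<le> a0"
    and r: "r > 0" "norm z > r"
    and sum: "summable (\<lambda>k. c k * of_real r ^ Suc k / z ^ (k + 2))"
  shows "cauchy_transform (circle_measure (fourier_density a0 c) r) z
    = a0 / z + (\<Sum>k. c k * of_real r ^ Suc k / z ^ (k + 2))"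
proof -
  let ?h = "fourier_density a0 c"
  define B where "B = \<bar>a0\<bar> + 2 * (\<Sum>k. norm (c k))"
  have h_le: "\<bar>?h t\<bar> \<le> B" for t
    unfolding B_def by (rule abs_fourier_density_le[OF c(1)])
  have z: "z \<noteq> 0" using r by auto
  define u where "u m t = ?h t * cis (2 * pi * int m * t) * (r ^ m / z ^ Suc m)" for m t
  have u_meas: "u m \<in> borel_measurable borel" for m
    unfolding u_def by measurable
  \<comment> \<open>A majorant independent of \<open>t\<close>, geometric with ratio r/|z| < 1; it
    justifies exchanging sum and integral.\<close>
  define b where "b m = B / norm z * (r / norm z) ^ m" for m
  have u_bound: "norm (u m t) \<le> b m" for m t
  proof -
    have "norm (u m t) = \<bar>?h t\<bar> * (r ^ m / norm z ^ Suc m)"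
      using r by (simp add: u_def norm_mult norm_divide norm_power)
    also have "\<dots> \<le> B * (r ^ m / norm z ^ Suc m)"
      using h_le r by (intro mult_right_mono) auto
    also have "\<dots> = b m" by (simp add: b_def power_divide)
    finally show ?thesis .
  qed
  have b_sum: "summable b"
    unfolding b_def using r by (intro summable_mult summable_geometric) (use z in \<open>simp add: divide_less_eq\<close>)
  have expand: "?h t * (1 / (z - r * cis (2 * pi * t))) = (\<Sum>m. u m t)" for t
  proof -
    define q where "q = r * cis (2 * pi * t) / z"
    have q: "norm q < 1" using r z by (simp add: q_def norm_mult norm_divide divide_less_eq)
    have "(\<lambda>m. ?h t / z * q ^ m) sums (?h t / z * (1 / (1 - q)))"
      by (rule sums_mult[OF geometric_sums[OF q]])
    moreover have "?h t / z * q ^ m = u m t" for m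
    proof -
      have "cis (2 * pi * t) ^ m = cis (2 * pi * int m * t)"
        using Complex.DeMoivre[of "2 * pi * t" m] by (simp only: mult_ac of_int_of_nat_eq)
      then show ?thesis
        by (simp add: u_def q_def power_divide power_mult_distrib)
    qed
    moreover have "?h t / z * (1 / (1 - q)) = ?h t * (1 / (z - r * cis (2 * pi * t)))"
      using z by (simp add: q_def right_diff_distrib)
    ultimately show ?thesis by (simp only: sums_unique)
  qed
  have moment: "(\<integral>t. u m t \<partial>unit_interval)
      = (case m of 0 \<Rightarrow> complex_of_real a0 | Suc k \<Rightarrow> c k) * (r ^ m / z ^ Suc m)" for m
    unfolding u_def integral_mult_left_zero integral_fourier_density_cis[OF c(1)] ..
  have "cauchy_transform (circle_measure ?h r) z
      = (\<integral>t. ?h t * (1 / (z - r * cis (2 * pi * t))) \<partial>unit_interval)"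
    unfolding cauchy_transform_def
    by (rule integral_circle_measure) (simp_all add: fourier_density_nonneg[OF c])
  also have "\<dots> = (\<Sum>m. \<integral>t. u m t \<partial>unit_interval)"
    unfolding expand by (rule integral_suminf_unit_interval[OF u_meas u_bound b_sum])
  also have "\<dots> = a0 / z + (\<Sum>k. c k * of_real r ^ Suc k / z ^ (k + 2))"
  proof -
    \<comment> \<open>The terms of index m = k+1 form the tail of the germ; \<open>sums_Suc\<close>
      then restores the term m = 0, which is \<open>a0 / z\<close>.\<close>
    have "(\<lambda>k. \<integral>t. u (Suc k) t \<partial>unit_interval) sums (\<Sum>k. c k * of_real r ^ Suc k / z ^ (k + 2))"
      using summable_sums[OF sum] unfolding moment by simp
    from sums_Suc[OF this] show ?thesis
      by (simp add: moment sums_unique[symmetric] add.commute)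
  qed
  finally show ?thesis .
qed

text \<open>The total mass is the moment of order 0, namely \<open>a0\<close>. It is needed to tell
  the measures apart, since zero measures on different circles would coincide.\<close>

lemma emeasure_circle_measure_fourier_density_neq_0:
  assumes c: "summable (\<lambda>k. norm (c k))" "2 * (\<Sum>k. norm (c k)) \<le> a0" and "a0 > 0"
  shows "emeasure (circle_measure (fourier_density a0 c) r) UNIV \<noteq> 0"
proof
  let ?\<mu> = "circle_measure (fourier_density a0 c) r"
  assume "emeasure ?\<mu> UNIV = 0"
  then have "measure ?\<mu> (space ?\<mu>) = 0"
    by (simp add: measure_def circle_measure_def)
  then have "(\<integral>\<xi>. (1::complex) \<partial>?\<mu>) = 0" by simp
  moreover have "(\<integral>\<xi>. (1::complex) \<partial>?\<mu>) = a0"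
    using integral_circle_measure[of "\<lambda>_. 1" "fourier_density a0 c" r]
      integral_fourier_density_cis[OF c(1), of a0 0] fourier_density_nonneg[OF c] by simp
  ultimately show False using \<open>a0 > 0\<close> by simp
qed

section \<open>Smallness of the Fourier coefficients for large radii\<close>

text \<open>Convergence at the single point \<open>R\<close> bounds the terms there, so |a_i| <= K
  R^i for i >= 2. A geometric majorant then bounds the sum of norms by K R^2 / (r - R), which tends
  to 0 as \<open>r\<close> grows.\<close>

lemma germ_coeffs_small:
  fixes a :: "nat \<Rightarrow> complex"
  assumes "R > 0" "summable (\<lambda>i. a (i + 2) / of_real R ^ (i + 2))" "\<epsilon> > 0"
  obtains r0 where "r0 > 0"
    "\<And>r. r \<ge> r0 \<Longrightarrow> summable (\<lambda>k. norm (a (k + 2) / of_real r ^ Suc k))"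
    "\<And>r. r \<ge> r0 \<Longrightarrow> 2 * (\<Sum>k. norm (a (k + 2) / of_real r ^ Suc k)) \<le> \<epsilon>"
proof -
  obtain K where K: "K > 0" "\<And>i. norm (a (i + 2) / of_real R ^ (i + 2)) \<le> K"
    using summable_imp_Bseq[OF assms(2)] by (auto simp: Bseq_def)
  have a_le: "norm (a (i + 2)) \<le> K * R ^ (i + 2)" for i
    using K(2)[of i] \<open>R > 0\<close> by (simp add: norm_divide norm_mult norm_power divide_le_eq)
  \<comment> \<open>The last summand is chosen so that r >= r0 forces 2 K R^2 / (r - R) <=
    \<epsilon>.\<close>
  define r0 where "r0 = R + 1 + 2 * K * R\<^sup>2 / \<epsilon>"
  have r0: "r0 > R" using assms K by (simp add: r0_def add_pos_nonneg)
  have main: "summable (\<lambda>k. norm (a (k + 2) / of_real r ^ Suc k))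
    \<and> 2 * (\<Sum>k. norm (a (k + 2) / of_real r ^ Suc k)) \<le> \<epsilon>" if "r \<ge> r0" for r
  proof -
    have r: "r > R" using that r0 by simp
    define b where "b k = K * R\<^sup>2 / r * (R / r) ^ k" for k
    have le: "norm (a (k + 2) / of_real r ^ Suc k) \<le> b k" for k
    proof -
      have "norm (a (k + 2) / of_real r ^ Suc k) = norm (a (k + 2)) / r ^ Suc k"
        using r assms(1) by (simp add: norm_divide norm_power norm_mult)
      also have "\<dots> \<le> K * R ^ (k + 2) / r ^ Suc k"
        using a_le r assms(1) by (intro divide_right_mono) auto
      also have "\<dots> = b k" by (simp add: b_def power_divide power_add power2_eq_square mult_ac)
      finally show ?thesis .
    qed
    have q: "norm (R / r) < 1" using r assms(1) by simp
    have b: "b sums (K * R\<^sup>2 / r * (1 / (1 - R / r)))"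
      unfolding b_def by (rule sums_mult[OF geometric_sums[OF q]])
    have sm: "summable (\<lambda>k. norm (a (k + 2) / of_real r ^ Suc k))"
      by (rule summable_comparison_test'[OF sums_summable[OF b], of 0]) (use le in simp)
    have "(\<Sum>k. norm (a (k + 2) / of_real r ^ Suc k)) \<le> K * R\<^sup>2 / r * (1 / (1 - R / r))"
      unfolding sums_unique[OF b] using le sm sums_summable[OF b] by (rule suminf_le)
    also have "\<dots> = K * R\<^sup>2 / (r - R)"
      using r assms(1) by (simp add: field_simps)
    finally have "2 * (\<Sum>k. norm (a (k + 2) / of_real r ^ Suc k)) \<le> 2 * K * R\<^sup>2 / (r - R)" by simp
    also have "\<dots> \<le> \<epsilon>"
    proof -
      have "2 * K * R\<^sup>2 / \<epsilon> \<le> r - R" using that by (simp add: r0_def)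
      then show ?thesis using r \<open>\<epsilon> > 0\<close> by (simp add: field_simps)
    qed
    finally show ?thesis using sm by simp
  qed
  show ?thesis using that[of r0] main r0 assms(1) by simp
qed

section \<open>The family of measures indexed by the radius\<close>

theorem theorem1:
  fixes f :: "complex \<Rightarrow> complex" and a0 :: real and a :: "nat \<Rightarrow> complex"
  assumes "a0 > 0"
    and "\<forall>\<^sub>F z in at_infinity.
           summable (\<lambda>i. a (i + 2) / z ^ (i + 2)) \<and>
           f z = complex_of_real a0 / z + (\<Sum>i. a (i + 2) / z ^ (i + 2))"
  shows "\<exists>\<mu> :: real \<Rightarrow> complex measure.
           inj \<mu> \<and>
           (\<forall>t. compactly_supported_borel_measure (\<mu> t) \<and>
                (\<forall>\<^sub>F z in at_infinity. cauchy_transform (\<mu> t) z = f z))"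
proof -
  obtain B where B: "\<And>z. norm z \<ge> B \<Longrightarrow> summable (\<lambda>i. a (i + 2) / z ^ (i + 2))"
    using assms(2) that unfolding eventually_at_infinity by metis
  \<comment> \<open>The maximum with 1 gives a positive real point of convergence even if
    \<open>B\<close> is not positive.\<close>
  have "summable (\<lambda>i. a (i + 2) / of_real (max B 1) ^ (i + 2))"
    by (rule B) simp
  then obtain r0 where r0: "r0 > 0"
    "\<And>r. r \<ge> r0 \<Longrightarrow> summable (\<lambda>k. norm (a (k + 2) / of_real r ^ Suc k))"
    "\<And>r. r \<ge> r0 \<Longrightarrow> 2 * (\<Sum>k. norm (a (k + 2) / of_real r ^ Suc k)) \<le> a0"
    by (rule germ_coeffs_small[rotated]) (use assms(1) in auto)
  define c where "c r k = a (k + 2) / of_real r ^ Suc k" for r k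
  note c = r0(2,3)[folded c_def]
  \<comment> \<open>The exponential injects the reals into the positive numbers, so all real
    parameters give distinct admissible radii above \<open>r0\<close>.\<close>
  define \<rho> where "\<rho> t = r0 + exp t" for t
  have \<rho>: "\<rho> t > 0" "\<rho> t \<ge> r0" for t
    using r0(1) by (simp_all add: \<rho>_def add_pos_pos)
  define \<mu> where "\<mu> t = circle_measure (fourier_density a0 (c (\<rho> t))) (\<rho> t)" for t
  have "inj \<mu>"
  proof (rule injI, rule ccontr)
    fix s t assume eq: "\<mu> s = \<mu> t" and "s \<noteq> t"
    then have ne: "\<rho> s \<noteq> \<rho> t" by (simp add: \<rho>_def)
    \<comment> \<open>Read as \<open>\<mu> t\<close>, the measure lives on a circle of another
      radius and ignores this one; read as \<open>\<mu> s\<close>, it ignores the complement. Its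
      total mass would then be 0.\<close>
    have "emeasure (\<mu> s) (sphere 0 (\<rho> s)) = 0"
      unfolding eq unfolding \<mu>_def using ne
      by (intro emeasure_circle_measure_outside[OF \<rho>(1)]) auto
    moreover have "emeasure (\<mu> s) (- sphere 0 (\<rho> s)) = 0"
      unfolding \<mu>_def by (intro emeasure_circle_measure_outside[OF \<rho>(1)]) auto
    ultimately have "emeasure (\<mu> s) (sphere 0 (\<rho> s) \<union> - sphere 0 (\<rho> s)) = 0"
      by (subst emeasure_Un_null_set) (auto simp: null_sets_def \<mu>_def sets_circle_measure)
    then show False
      using emeasure_circle_measure_fourier_density_neq_0[OF c(1)[OF \<rho>(2)] c(2)[OF \<rho>(2)] assms(1)]
      by (simp add: \<mu>_def)
  qed
  moreover have "compactly_supported_borel_measure (\<mu> t)" for t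
    unfolding compactly_supported_borel_measure_def \<mu>_def
    using finite_circle_measure[OF fourier_density_measurable abs_fourier_density_le[OF c(1)[OF \<rho>(2)]]]
    by (simp add: sets_circle_measure compact_measure_support_circle_measure[OF \<rho>(1)])
  moreover have "\<forall>\<^sub>F z in at_infinity. cauchy_transform (\<mu> t) z = f z" for t
  proof -
    have "\<forall>\<^sub>F z::complex in at_infinity. norm z \<ge> \<rho> t + 1"
      by (auto simp: eventually_at_infinity)
    with assms(2) show ?thesis
    proof eventually_elim
      case (elim z)
      \<comment> \<open>The power of the radius cancels the denominator built into \<open>c\<close>,
        so the resulting transform no longer depends on \<open>t\<close>.\<close>
      have coeff: "c (\<rho> t) k * of_real (\<rho> t) ^ Suc k / z ^ (k + 2) = a (k + 2) / z ^ (k + 2)" for k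
        using \<rho>(1)[of t] by (simp add: c_def)
      have "norm z > \<rho> t" using elim by simp
      from cauchy_transform_circle_measure[OF c(1)[OF \<rho>(2)[of t]] c(2)[OF \<rho>(2)[of t]]
          \<rho>(1) this, unfolded coeff]
      show ?case
        unfolding \<mu>_def using elim by (simp only:)
    qed
  qed
  ultimately show ?thesis by blast
qed

end
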